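(* Let $p$ be an odd prime and let $n\ge 1$. Let $\mathcal{CI}(n,\mathbb{Z}_p[i])$ denote the number of coninvolutions in the upper triangular matrix group $T_n(\mathbb{Z}_p[i])$, i.e. the number of $A\in T_n(\mathbb{Z}_p[i])$ with $A\bar A=I_n$. Then $$\mathcal{CI}(n,\mathbb{Z}_p[i])=|U(\mathbb{Z}_p[i])|^n\cdot p^{\frac{(n-1)n}{2}},$$ where $|U(\mathbb{Z}_p[i])|$ denotes the cardinality of $U(\mathbb{Z}_p[i])=\{z\in\mathbb{Z}_p[i] : |z|^2=1\}$.
   Context: $\mathbb{Z}_p=\mathbb{Z}/p\mathbb{Z}$. The ring of Gaussian integers modulo $p$ is $\mathbb{Z}_p[i]=\{a+ib : a,b\in\mathbb{Z}_p\}$ with $i^2=-1$; that is, $\mathbb{Z}_p[i]=\mathbb{Z}_p[x]/(x^2+1)$, with each element written uniquely as $a+ib$. (It need not be a field.) For $z=a+ib$, the conjugate is $\bar z=a-ib$ and $|z|^2=z\bar z=a^2+b^2\in\mathbb{Z}_p$. $T_n(\mathbb{Z}_p[i])$ is the group of $n\times n$ upper triangular (invertible) matrices with entries in $\mathbb{Z}_p[i]$. For a matrix $A=(z_{rs})$, $\bar A=(\bar z_{rs})$ is the entrywise conjugate (no transposition). $A$ is called a coninvolution if $A\bar A=I_n$, where $I_n$ is the identity matrix. *)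

theory Defs
  imports "Berlekamp_Zassenhaus.Finite_Field" "Jordan_Normal_Form.Matrix"
begin

text \<open>
  \<open>'a gauss\<close> is \<open>R[i] = R[x]/(x\<^sup>2 + 1)\<close> over an arbitrary commutative ring \<open>R\<close>;
  \<open>Gauss a b\<close> is the normal form \<open>a + i b\<close> of a residue class.
  The Gaussian integers modulo \<open>p\<close> are \<open>'p mod_ring gauss\<close> with \<open>CARD('p) = p\<close>.
\<close>

datatype 'a gauss = Gauss (re_part: 'a) (im_part: 'a)

lemma gauss_eq_iff: "z = w \<longleftrightarrow> re_part z = re_part w \<and> im_part z = im_part w"
  by (cases z; cases w) simp

instantiation gauss :: (comm_ring_1) comm_ring_1
begin

definition zero_gauss :: "'a gauss" where "0 = Gauss 0 0"

definition one_gauss :: "'a gauss" where "1 = Gauss 1 0"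

definition plus_gauss :: "'a gauss \<Rightarrow> 'a gauss \<Rightarrow> 'a gauss" where
  "z + w = Gauss (re_part z + re_part w) (im_part z + im_part w)"

definition minus_gauss :: "'a gauss \<Rightarrow> 'a gauss \<Rightarrow> 'a gauss" where
  "z - w = Gauss (re_part z - re_part w) (im_part z - im_part w)"

definition uminus_gauss :: "'a gauss \<Rightarrow> 'a gauss" where
  "- z = Gauss (- re_part z) (- im_part z)"

definition times_gauss :: "'a gauss \<Rightarrow> 'a gauss \<Rightarrow> 'a gauss" where
  "z * w = Gauss (re_part z * re_part w - im_part z * im_part w)
                 (re_part z * im_part w + im_part z * re_part w)"

instance
  by standard
    (simp_all add: gauss_eq_iff zero_gauss_def one_gauss_def plus_gauss_def minus_gauss_def
      uminus_gauss_def times_gauss_def algebra_simps)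

end

lemma gauss_i_squared: "Gauss 0 1 * Gauss 0 1 = - (1 :: 'a :: comm_ring_1 gauss)"
  by (simp add: one_gauss_def uminus_gauss_def times_gauss_def)

lemma gauss_decomp: "(Gauss a b :: 'a :: comm_ring_1 gauss) = Gauss a 0 + Gauss 0 1 * Gauss b 0"
  by (simp add: plus_gauss_def times_gauss_def)

definition gauss_cnj :: "'a :: comm_ring_1 gauss \<Rightarrow> 'a gauss" where
  "gauss_cnj z = Gauss (re_part z) (- im_part z)"

text \<open>The square modulus, as an element of the base ring.\<close>

definition gauss_norm2 :: "'a :: comm_ring_1 gauss \<Rightarrow> 'a" where
  "gauss_norm2 z = (re_part z)\<^sup>2 + (im_part z)\<^sup>2"

lemma mult_gauss_cnj: "z * gauss_cnj z = Gauss (gauss_norm2 z) 0"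
  by (simp add: gauss_cnj_def gauss_norm2_def times_gauss_def power2_eq_square algebra_simps)

definition gauss_unit_circle :: "'a :: comm_ring_1 gauss set" where
  "gauss_unit_circle = {z. gauss_norm2 z = 1}"

definition upper_triangular_group :: "nat \<Rightarrow> 'a :: comm_ring_1 mat set" where
  "upper_triangular_group n =
     {A \<in> carrier_mat n n. upper_triangular A \<and> invertible_mat A}"

definition coninvolution :: "'a :: comm_ring_1 gauss mat \<Rightarrow> bool" where
  "coninvolution A \<longleftrightarrow> A * map_mat gauss_cnj A = 1\<^sub>m (dim_row A)"

end

theory Submission
  imports Defs
begin

text \<open>
  A block upper triangular matrix with diagonal blocks \<open>A\<close>, \<open>D\<close> and corner \<open>X\<close> is a
  coninvolution iff \<open>A\<close> and \<open>D\<close> are and \<open>X\<close> is fixed by \<open>T X = - A cnj(X) D\<close>. This \<open>T\<close> is a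
  conjugate-linear involution, so multiplication by \<open>i\<close> exchanges its fixed points with its
  anti-fixed points. As \<open>2\<close> is invertible, the space of all corners is the direct sum
  of these two, whence the number of fixed points is the square root of its size.
  Splitting off \<open>1 \<times> 1\<close> blocks gives the count.
\<close>

section \<open>Conjugation\<close>

interpretation gauss_cnj: comm_ring_hom "gauss_cnj :: 'a :: comm_ring_1 gauss \<Rightarrow> 'a gauss"
  by standard (simp_all add: gauss_cnj_def gauss_eq_iff zero_gauss_def one_gauss_def
      plus_gauss_def times_gauss_def)

lemma gauss_cnj_cnj [simp]: "gauss_cnj (gauss_cnj z) = z"
  by (simp add: gauss_cnj_def gauss_eq_iff)

lemma gauss_cnj_of_base [simp]: "gauss_cnj (Gauss a 0) = Gauss a 0"
  by (simp add: gauss_cnj_def)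

abbreviation gauss_i :: "'a :: comm_ring_1 gauss" where
  "gauss_i \<equiv> Gauss 0 1"

lemma gauss_cnj_i [simp]: "gauss_cnj gauss_i = - (gauss_i :: 'a :: comm_ring_1 gauss)"
  by (simp add: gauss_cnj_def uminus_gauss_def)

lemma map_mat_cnj_cnj [simp]: "map_mat gauss_cnj (map_mat gauss_cnj A) = A"
  by (rule eq_matI) auto

lemma mult_gauss_cnj_eq_1_iff: "z * gauss_cnj z = 1 \<longleftrightarrow> z \<in> gauss_unit_circle"
  by (simp add: mult_gauss_cnj gauss_unit_circle_def one_gauss_def)

section \<open>Finiteness and cardinalities of matrix spaces\<close>

instance gauss :: (finite) finite
proof
  have "(UNIV :: 'a gauss set) = range (\<lambda>(a, b). Gauss a b)"
    by (metis UNIV_eq_I gauss.exhaust_sel old.prod.case rangeI)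
  then show "finite (UNIV :: 'a gauss set)"
    by (metis finite finite_imageI)
qed

lemma CARD_gauss: "CARD('a :: finite gauss) = CARD('a)\<^sup>2"
proof -
  have "bij (\<lambda>(a :: 'a, b). Gauss a b)"
    by (intro o_bij[where g = "\<lambda>z. (re_part z, im_part z)"]) (auto simp: fun_eq_iff)
  from bij_betw_same_card[OF this] show ?thesis
    by (simp add: power2_eq_square)
qed

lemma card_carrier_mat:
  "card (carrier_mat n m :: 'a :: finite mat set) = CARD('a) ^ (n * m)"
proof -
  let ?P = "({0..<n} \<times> {0..<m}) \<rightarrow>\<^sub>E (UNIV :: 'a set)"
  have "bij_betw (mat n m) ?P (carrier_mat n m)"
  \<comment> \<open>Members of \<open>?P\<close> are \<open>undefined\<close> outside the index
    rectangle; \<open>restrict\<close> restores this value, so that reading off the entries of a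
    matrix inverts \<open>mat n m\<close>.\<close>
  proof (rule bij_betw_byWitness[where f' = "\<lambda>A. restrict (\<lambda>ij. A $$ ij) ({0..<n} \<times> {0..<m})"])
    show "\<forall>f\<in>?P. restrict (\<lambda>ij. mat n m f $$ ij) ({0..<n} \<times> {0..<m}) = f"
    proof (intro ballI ext)
      fix f ij assume f: "f \<in> ?P"
      show "restrict (\<lambda>ij. mat n m f $$ ij) ({0..<n} \<times> {0..<m}) ij = f ij"
      proof (cases "ij \<in> {0..<n} \<times> {0..<m}")
        case True
        then show ?thesis by (cases ij) simp
      next
        case False
        with PiE_arb[OF f] show ?thesis by simp
      qed
    qed
  qed (auto intro!: eq_matI split: if_splits)
  from bij_betw_same_card[OF this] show ?thesis
    by (simp add: card_PiE)
qed

section \<open>Fixed points of conjugate-linear involutions\<close>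

text \<open>\<open>T\<close> acts as a complex conjugation on the space of matrices. Its fixed
  points are the real matrices for it, and each matrix is uniquely \<open>X\<close> plus i times
  \<open>Y\<close> with \<open>X\<close> and \<open>Y\<close> real in this sense.\<close>

lemma card_conjugate_linear_fixed_points:
  fixes T :: "'a :: {comm_ring_1, finite} gauss mat \<Rightarrow> 'a gauss mat"
  assumes half: "2 * h = (1 :: 'a)"
    and T: "\<And>X. X \<in> carrier_mat n m \<Longrightarrow> T X \<in> carrier_mat n m"
    and T_add: "\<And>X Y. X \<in> carrier_mat n m \<Longrightarrow> Y \<in> carrier_mat n m \<Longrightarrow> T (X + Y) = T X + T Y"
    and T_smult: "\<And>c X. X \<in> carrier_mat n m \<Longrightarrow> T (c \<cdot>\<^sub>m X) = gauss_cnj c \<cdot>\<^sub>m T X"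
    and T_T: "\<And>X. X \<in> carrier_mat n m \<Longrightarrow> T (T X) = X"
  shows "card {X \<in> carrier_mat n m. T X = X} = CARD('a) ^ (n * m)"
proof -
  let ?F = "{X \<in> carrier_mat n m. T X = X}"
  \<comment> \<open>One half, embedded as a self-conjugate scalar.\<close>
  define c :: "'a gauss" where "c = Gauss h 0"
  have c: "gauss_cnj c = c" by (simp add: c_def)
  have cz: "c * z + c * z = z" for z
    using half by (simp add: c_def plus_gauss_def times_gauss_def gauss_eq_iff)
      (metis distrib_right mult_2 mult_1_left)
  have c2: "c * (2 * z) = z" for z
    by (metis cz distrib_left mult_2)
  have cnj_ic: "gauss_cnj (gauss_i * c) = - (gauss_i * c)"
    by (simp add: gauss_cnj.hom_mult c)
  have ii: "gauss_i * (gauss_i * z) = - z" for z :: "'a gauss"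
    by (simp add: mult.assoc[symmetric] gauss_i_squared)
  \<comment> \<open>Real and imaginary parts with respect to \<open>T\<close>: (Z + T Z)/2 and (Z -
    T Z)/(2i), where 1/i = -i. The difference is written with the scalar -1 so that
    \<open>T_add\<close> and \<open>T_smult\<close> apply to it.\<close>
  let ?re = "\<lambda>Z. c \<cdot>\<^sub>m (Z + T Z)"
  let ?im = "\<lambda>Z. (- (gauss_i * c)) \<cdot>\<^sub>m (Z + (- 1) \<cdot>\<^sub>m T Z)"
  have "bij_betw (\<lambda>(X, Y). X + gauss_i \<cdot>\<^sub>m Y) (?F \<times> ?F) (carrier_mat n m)"
  proof (rule bij_betw_byWitness[where f' = "\<lambda>Z. (?re Z, ?im Z)"])
    show "\<forall>XY\<in>?F \<times> ?F. (\<lambda>Z. (?re Z, ?im Z)) (case XY of (X, Y) \<Rightarrow> X + gauss_i \<cdot>\<^sub>m Y) = XY"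
    proof clarify
      fix X Y assume X: "X \<in> carrier_mat n m" "T X = X" and Y: "Y \<in> carrier_mat n m" "T Y = Y"
      have TZ: "T (X + gauss_i \<cdot>\<^sub>m Y) = X + (- gauss_i) \<cdot>\<^sub>m Y"
        using X Y by (simp add: T_add T_smult)
      show "?re (X + gauss_i \<cdot>\<^sub>m Y) = X \<and> ?im (X + gauss_i \<cdot>\<^sub>m Y) = Y"
        unfolding TZ using X(1) Y(1)
        by (auto intro!: eq_matI simp: algebra_simps cz c2 ii)
    qed
    show "\<forall>Z\<in>carrier_mat n m. (case (?re Z, ?im Z) of (X, Y) \<Rightarrow> X + gauss_i \<cdot>\<^sub>m Y) = Z"
    proof
      fix Z :: "'a gauss mat" assume "Z \<in> carrier_mat n m"
      with T[OF this] show "(case (?re Z, ?im Z) of (X, Y) \<Rightarrow> X + gauss_i \<cdot>\<^sub>m Y) = Z"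
        by (auto intro!: eq_matI simp: algebra_simps cz c2 ii)
    qed
    show "(\<lambda>(X, Y). X + gauss_i \<cdot>\<^sub>m Y) ` (?F \<times> ?F) \<subseteq> carrier_mat n m"
      by auto
    show "(\<lambda>Z. (?re Z, ?im Z)) ` carrier_mat n m \<subseteq> ?F \<times> ?F"
    proof (rule image_subsetI)
      fix Z :: "'a gauss mat" assume Z: "Z \<in> carrier_mat n m"
      have "T (?re Z) = c \<cdot>\<^sub>m (T Z + Z)"
        using Z T[OF Z] by (simp add: T_add T_smult T_T c)
      also have "\<dots> = ?re Z"
        using Z T[OF Z] by (auto intro!: eq_matI simp: algebra_simps)
      finally have re: "T (?re Z) = ?re Z" .
      \<comment> \<open>Two signs cancel: conjugation negates the scalar, and \<open>T\<close> turns
        Z - T Z into its negative.\<close>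
      have "T (?im Z) = (gauss_i * c) \<cdot>\<^sub>m (T Z + (- 1) \<cdot>\<^sub>m Z)"
        using Z T[OF Z] by (simp add: T_add T_smult T_T cnj_ic gauss_cnj.hom_uminus)
      also have "\<dots> = ?im Z"
        using Z T[OF Z] by (auto intro!: eq_matI simp: algebra_simps)
      finally show "(?re Z, ?im Z) \<in> ?F \<times> ?F"
        using re Z T[OF Z] by simp
    qed
  qed
  \<comment> \<open>An entry has \<open>CARD('a)\<close> squared possible values, so both sides are
    squares of natural numbers and the bases agree.\<close>
  from bij_betw_same_card[OF this] have "(card ?F)\<^sup>2 = (CARD('a) ^ (n * m))\<^sup>2"
    by (simp add: card_cartesian_product card_carrier_mat CARD_gauss power2_eq_square
        power_mult_distrib)
  then show ?thesis by simp
qed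

section \<open>Coninvolutions\<close>

definition coninvolutions :: "nat \<Rightarrow> 'a :: comm_ring_1 gauss mat set" where
  "coninvolutions n =
     {A \<in> carrier_mat n n. upper_triangular A \<and> A * map_mat gauss_cnj A = 1\<^sub>m n}"

text \<open>Conjugation is an involutive ring homomorphism, so conjugating the equation entrywise
  exchanges its two factors.\<close>

lemma coninvolution_inverse:
  fixes A :: "'a :: comm_ring_1 gauss mat"
  assumes A: "A \<in> carrier_mat n n" and eq: "A * map_mat gauss_cnj A = 1\<^sub>m n"
  shows "map_mat gauss_cnj A * A = 1\<^sub>m n"
proof -
  have "map_mat gauss_cnj (A * map_mat gauss_cnj A) = map_mat gauss_cnj A * A"
    using A by (subst gauss_cnj.mat_hom_mult) auto
  then show ?thesis by (simp add: eq gauss_cnj.mat_hom_one)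
qed

text \<open>The equation and its conjugate make \<open>map_mat gauss_cnj A\<close> a two-sided
  inverse of \<open>A\<close>.\<close>

lemma coninvolutions_eq:
  "{A \<in> upper_triangular_group n. coninvolution A} = coninvolutions n"
proof -
  have "invertible_mat A"
    if "A \<in> carrier_mat n n" "A * map_mat gauss_cnj A = 1\<^sub>m n" for A :: "'a gauss mat"
    using that coninvolution_inverse[OF that]
    unfolding invertible_mat_def inverts_mat_def square_mat.simps by auto
  then show ?thesis
    by (auto simp: upper_triangular_group_def coninvolutions_def coninvolution_def)
qed

text \<open>The equation in \<open>X\<close> says that the upper right corner of M cnj(M) vanishes,
  where M has diagonal blocks \<open>A\<close>, \<open>D\<close> and corner \<open>X\<close>. Since
  \<open>D\<close> inverts its conjugate, it is a fixed point equation for \<open>T\<close>.\<close>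

lemma card_coninvolution_corners:
  fixes A D :: "'a :: {comm_ring_1, finite} gauss mat"
  assumes half: "2 * h = (1 :: 'a)"
    and A: "A \<in> carrier_mat n n" "A * map_mat gauss_cnj A = 1\<^sub>m n"
    and D: "D \<in> carrier_mat m m" "D * map_mat gauss_cnj D = 1\<^sub>m m"
  shows "card {X \<in> carrier_mat n m. A * map_mat gauss_cnj X + X * map_mat gauss_cnj D = 0\<^sub>m n m}
    = CARD('a) ^ (n * m)"
proof -
  define T where "T X = - (A * map_mat gauss_cnj X * D)" for X
  note D' = coninvolution_inverse[OF D]
  have T: "T X \<in> carrier_mat n m" if "X \<in> carrier_mat n m" for X
    using that A D by (simp add: T_def)
  \<comment> \<open>Applying \<open>T\<close> twice gives A cnj(A) X cnj(D) D with the signs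
    cancelled. The left pair is 1 by assumption, the right pair by \<open>D'\<close>.\<close>
  have T_T: "T (T X) = X" if X: "X \<in> carrier_mat n m" for X
  proof -
    let ?A = "map_mat gauss_cnj A" and ?D = "map_mat gauss_cnj D"
    have "map_mat gauss_cnj (T X) = - map_mat gauss_cnj (A * map_mat gauss_cnj X * D)"
      using A D X by (auto intro!: eq_matI simp: T_def hom_distribs)
    also have "map_mat gauss_cnj (A * map_mat gauss_cnj X * D) = ?A * X * ?D"
      using A D X by (simp add: gauss_cnj.mat_hom_mult[of _ n m _ m] gauss_cnj.mat_hom_mult[of _ n n _ m])
    finally have "T (T X) = - (A * (- (?A * X * ?D)) * D)"
      by (simp add: T_def)
    also have "\<dots> = A * (?A * X * ?D) * D"
      using A D X by simp
    also have "\<dots> = (A * ?A) * X * (?D * D)"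
      using A(1) D(1) X by (simp add: assoc_mult_mat[of _ n n _ m _ m] assoc_mult_mat[of _ n n _ n _ m]
          assoc_mult_mat[of _ n m _ m _ m])
    finally show ?thesis using A D D' X by simp
  qed
  have card_fixed: "card {X \<in> carrier_mat n m. T X = X} = CARD('a) ^ (n * m)"
  proof (rule card_conjugate_linear_fixed_points[OF half T _ _ T_T])
    fix X Y :: "'a gauss mat" assume X: "X \<in> carrier_mat n m" and Y: "Y \<in> carrier_mat n m"
    have "map_mat gauss_cnj (X + Y) = map_mat gauss_cnj X + map_mat gauss_cnj Y"
      using X Y by (auto intro!: eq_matI simp: hom_distribs)
    then show "T (X + Y) = T X + T Y"
      using A D X Y
      by (simp add: T_def mult_add_distrib_mat[of _ n n _ m] add_mult_distrib_mat[of _ n m _ _ m])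
        (auto intro!: eq_matI)
  next
    fix b and X :: "'a gauss mat" assume X: "X \<in> carrier_mat n m"
    have "map_mat gauss_cnj (b \<cdot>\<^sub>m X) = gauss_cnj b \<cdot>\<^sub>m map_mat gauss_cnj X"
      using X by (auto intro!: eq_matI simp: hom_distribs)
    then show "T (b \<cdot>\<^sub>m X) = gauss_cnj b \<cdot>\<^sub>m T X"
      using A D X
      by (simp add: T_def mult_smult_distrib[of _ n n _ m] mult_smult_assoc_mat[of _ n m _ m])
        (auto intro!: eq_matI)
  qed
  \<comment> \<open>Right multiplication by the conjugate of \<open>D\<close> leads from the fixed
    point equation to the corner equation; right multiplication by \<open>D\<close> leads
    back.\<close>
  have fixed_iff: "T X = X \<longleftrightarrow> A * map_mat gauss_cnj X + X * map_mat gauss_cnj D = 0\<^sub>m n m"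
    (is "_ \<longleftrightarrow> ?P + ?Q = _") if X: "X \<in> carrier_mat n m" for X
  proof -
    have PQ: "?P \<in> carrier_mat n m" "?Q \<in> carrier_mat n m"
      using A D X by auto
    have QD: "?Q * D = X"
      using D D' X by (simp add: assoc_mult_mat[of _ n m _ m _ m])
    show ?thesis
    proof
      assume "T X = X"
      then have "?Q = - (?P * D) * map_mat gauss_cnj D" by (simp add: T_def)
      also have "\<dots> = - (?P * (D * map_mat gauss_cnj D))"
        using D(1) PQ(1) by (simp add: assoc_mult_mat[of _ n m _ m _ m])
      also have "\<dots> = - ?P"
        using PQ(1) by (simp add: D(2) right_mult_one_mat[of _ n m])
      finally show "?P + ?Q = 0\<^sub>m n m"
        using PQ(1) comm_add_mat[OF PQ(1), of "- ?P"] by simp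
    next
      assume "?P + ?Q = 0\<^sub>m n m"
      then have "(?P + ?Q) * D = 0\<^sub>m n m" using D by simp
      then have 0: "?P * D + X = 0\<^sub>m n m"
        using PQ D by (simp add: add_mult_distrib_mat[of _ n m _ _ m] QD)
      have "R + X = 0\<^sub>m n m \<Longrightarrow> - R = X" if R: "R \<in> carrier_mat n m" for R
      proof (rule eq_matI)
        fix i j assume "R + X = 0\<^sub>m n m" and ij: "i < dim_row X" "j < dim_col X"
        then have "(R + X) $$ (i, j) = 0" using X by simp
        with X R ij have "R $$ (i, j) + X $$ (i, j) = 0" by simp
        then have "- (R $$ (i, j)) = X $$ (i, j)" by (rule minus_unique)
        with X R ij show "(- R) $$ (i, j) = X $$ (i, j)" by simp
      qed (use X R in auto)
      from this[OF mult_carrier_mat[OF PQ(1) D(1)] 0] show "T X = X"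
        by (simp only: T_def)
    qed
  qed
  have "{X \<in> carrier_mat n m. A * map_mat gauss_cnj X + X * map_mat gauss_cnj D = 0\<^sub>m n m} =
      {X \<in> carrier_mat n m. T X = X}"
    using fixed_iff by blast
  then show ?thesis by (simp only: card_fixed)
qed

text \<open>Cutting after \<open>n\<close> rows and columns maps a coninvolution to its pair of
  diagonal blocks. The fibre over a pair is its set of admissible corners, whose size does not
  depend on the pair.\<close>

lemma card_coninvolutions_add:
  assumes half: "2 * h = (1 :: 'a :: {comm_ring_1, finite})"
  shows "card (coninvolutions (n + m) :: 'a gauss mat set) =
    card (coninvolutions n :: 'a gauss mat set) * card (coninvolutions m :: 'a gauss mat set) *
    CARD('a) ^ (n * m)"
proof -
  let ?C = "coninvolutions :: nat \<Rightarrow> 'a gauss mat set"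
  define S where "S A D = {X \<in> carrier_mat n m.
    A * map_mat gauss_cnj X + X * map_mat gauss_cnj D = 0\<^sub>m n m}" for A D :: "'a gauss mat"
  define block where "block A D X = four_block_mat A X (0\<^sub>m m n) D" for A D X :: "'a gauss mat"
  have block_mult: "block A D X * map_mat gauss_cnj (block A D X) =
      four_block_mat (A * map_mat gauss_cnj A)
        (A * map_mat gauss_cnj X + X * map_mat gauss_cnj D) (0\<^sub>m m n) (D * map_mat gauss_cnj D)"
    if "A \<in> carrier_mat n n" "D \<in> carrier_mat m m" "X \<in> carrier_mat n m" for A D X
  proof -
    have 0: "map_mat gauss_cnj (0\<^sub>m m n) = (0\<^sub>m m n :: 'a gauss mat)"
      by (auto intro!: eq_matI)
    show ?thesis
      using that unfolding block_def
      by (simp add: map_four_block_mat[of _ n n _ m _ m] 0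
          mult_four_block_mat[of _ n n _ m _ m _ _ n _ m])
  qed
  \<comment> \<open>The blocks are recovered from the entries, with rows or columns shifted by
    \<open>n\<close> outside the upper left block.\<close>
  have block_inj: "A = A' \<and> X = X' \<and> D = D'"
    if eq: "four_block_mat A X E D = four_block_mat A' X' E D'"
      and A: "A \<in> carrier_mat n n" "A' \<in> carrier_mat n n"
      and D: "D \<in> carrier_mat m m" "D' \<in> carrier_mat m m"
      and X: "X \<in> carrier_mat n m" "X' \<in> carrier_mat n m"
      and E: "E \<in> carrier_mat m n"
    for A A' X X' D D' E :: "'a gauss mat"
  proof (intro conjI)
    have ij: "four_block_mat A X E D $$ (i, j) = four_block_mat A' X' E D' $$ (i, j)" for i j
      by (simp add: eq)
    show "A = A'"
    proof (rule eq_matI)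
      fix i j assume "i < dim_row A'" "j < dim_col A'"
      with ij[of i j] A X E D show "A $$ (i, j) = A' $$ (i, j)" by simp
    qed (use A in auto)
    show "X = X'"
    proof (rule eq_matI)
      fix i j assume "i < dim_row X'" "j < dim_col X'"
      with ij[of i "n + j"] A X E D show "X $$ (i, j) = X' $$ (i, j)" by simp
    qed (use X in auto)
    show "D = D'"
    proof (rule eq_matI)
      fix i j assume "i < dim_row D'" "j < dim_col D'"
      with ij[of "n + i" "n + j"] A X E D show "D $$ (i, j) = D' $$ (i, j)" by simp
    qed (use D in auto)
  qed
  have block_iff: "block A D X * map_mat gauss_cnj (block A D X) = 1\<^sub>m (n + m) \<longleftrightarrow>
      A * map_mat gauss_cnj A = 1\<^sub>m n \<and> D * map_mat gauss_cnj D = 1\<^sub>m m \<and> X \<in> S A D"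
    if A: "A \<in> carrier_mat n n" and D: "D \<in> carrier_mat m m" and X: "X \<in> carrier_mat n m"
    for A D X
  proof -
    have "block A D X * map_mat gauss_cnj (block A D X) = 1\<^sub>m (n + m) \<longleftrightarrow>
      four_block_mat (A * map_mat gauss_cnj A)
        (A * map_mat gauss_cnj X + X * map_mat gauss_cnj D) (0\<^sub>m m n) (D * map_mat gauss_cnj D)
      = four_block_mat (1\<^sub>m n) (0\<^sub>m n m) (0\<^sub>m m n) (1\<^sub>m m)"
      by (simp add: block_mult[OF that])
    also have "\<dots> \<longleftrightarrow> A * map_mat gauss_cnj A = 1\<^sub>m n \<and> D * map_mat gauss_cnj D = 1\<^sub>m m \<and>
        A * map_mat gauss_cnj X + X * map_mat gauss_cnj D = 0\<^sub>m n m"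
      using block_inj[of "A * map_mat gauss_cnj A" "A * map_mat gauss_cnj X + X * map_mat gauss_cnj D"
          "0\<^sub>m m n" "D * map_mat gauss_cnj D" "1\<^sub>m n" "0\<^sub>m n m" "1\<^sub>m m"] that
      by auto
    finally show ?thesis using X by (auto simp: S_def)
  qed
  have S_sub: "S A D \<subseteq> carrier_mat n m" for A D by (auto simp: S_def)
  have C_sub: "?C k \<subseteq> carrier_mat k k" for k by (auto simp: coninvolutions_def)
  \<comment> \<open>A dependent sum, because the admissible corners vary with the diagonal
    blocks.\<close>
  let ?P = "Sigma (?C n \<times> ?C m) (\<lambda>(A, D). S A D)"
  let ?f = "\<lambda>((A, D), X). block A D X"
  have "bij_betw ?f ?P (?C (n + m))"
  proof (rule bij_betw_imageI)
    show "inj_on ?f ?P"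
      unfolding inj_on_def block_def using C_sub S_sub
      by (auto 0 3 dest!: block_inj simp: subset_iff)
    show "?f ` ?P = ?C (n + m)"
    proof (intro equalityI subsetI)
      fix M assume "M \<in> ?f ` ?P"
      then obtain A D X where M: "M = block A D X" "A \<in> ?C n" "D \<in> ?C m" "X \<in> S A D" by auto
      then have "A \<in> carrier_mat n n" "D \<in> carrier_mat m m" "X \<in> carrier_mat n m"
        using C_sub[of n] C_sub[of m] S_sub[of A D] by auto
      from block_iff[OF this] this M show "M \<in> ?C (n + m)"
        by (auto simp: coninvolutions_def block_def intro!: upper_triangular_four_block)
    next
      fix M assume "M \<in> ?C (n + m)"
      then have M: "M \<in> carrier_mat (n + m) (n + m)" "upper_triangular M"
        "M * map_mat gauss_cnj M = 1\<^sub>m (n + m)"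
        by (auto simp: coninvolutions_def)
      obtain A X E D where sp: "split_block M n n = (A, X, E, D)" by (metis surj_pair)
      note spl = split_block[OF sp, of m m]
      have car: "A \<in> carrier_mat n n" "X \<in> carrier_mat n m" "E \<in> carrier_mat m n"
        "D \<in> carrier_mat m m" and Meq: "M = four_block_mat A X E D"
        using spl M by auto
      have ut: "M $$ (i, j) = 0" if "j < i" "i < n + m" for i j
        using M that by auto
      \<comment> \<open>Entry (i, j) of \<open>E\<close> is entry (n + i, j) of \<open>M\<close>
        with j < n, hence strictly below the diagonal.\<close>
      have "E = 0\<^sub>m m n"
      proof (rule eq_matI)
        fix i j assume "i < dim_row (0\<^sub>m m n)" "j < dim_col (0\<^sub>m m n)"
        with ut[of j "n + i"] car show "E $$ (i, j) = 0\<^sub>m m n $$ (i, j)"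
          by (simp add: Meq)
      qed (use car in auto)
      then have Mb: "M = block A D X" by (simp add: Meq block_def)
      have "upper_triangular A"
      proof
        fix i j assume "j < i" "i < dim_row A"
        with ut[of j i] car show "A $$ (i, j) = 0" by (simp add: Meq)
      qed
      moreover have "upper_triangular D"
      proof
        fix i j assume "j < i" "i < dim_row D"
        with ut[of "n + j" "n + i"] car show "D $$ (i, j) = 0" by (simp add: Meq)
      qed
      ultimately have "A \<in> ?C n" "D \<in> ?C m" "X \<in> S A D"
        using block_iff[OF car(1,4,2)] M(3) car by (auto simp: Mb coninvolutions_def)
      then show "M \<in> ?f ` ?P" by (force simp: Mb)
    qed
  qed
  then have "card (?C (n + m)) = card ?P" by (simp add: bij_betw_same_card)
  also have "\<dots> = (\<Sum>(A, D)\<in>?C n \<times> ?C m. card (S A D))"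
  proof -
    \<comment> \<open>Infinite sets have \<open>card\<close> 0, so a positive cardinality proves
      finiteness.\<close>
    have fin: "finite (carrier_mat k l :: 'a gauss mat set)" for k l
      by (rule card_ge_0_finite) (simp add: card_carrier_mat)
    show ?thesis
      using finite_subset[OF C_sub fin] finite_subset[OF S_sub fin]
      by (subst card_SigmaI) (auto intro!: sum.cong)
  qed
  also have "\<dots> = (\<Sum>(A, D)\<in>?C n \<times> ?C m. CARD('a) ^ (n * m))"
    unfolding S_def
    by (intro sum.cong refl) (auto simp: coninvolutions_def intro!: card_coninvolution_corners[OF half])
  also have "\<dots> = card (?C n) * card (?C m) * CARD('a) ^ (n * m)"
    by (simp add: card_cartesian_product)
  finally show ?thesis .
qed

section \<open>Blocks of size one and induction on the size\<close>

lemma card_coninvolutions_1: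
  "card (coninvolutions 1 :: 'a :: comm_ring_1 gauss mat set) =
   card (gauss_unit_circle :: 'a gauss set)"
proof -
  let ?f = "\<lambda>d :: 'a gauss. mat 1 1 (\<lambda>_. d)"
  \<comment> \<open>For a single entry the equation says that the entry times its conjugate is 1,
    which is the norm condition.\<close>
  have iff: "A * map_mat gauss_cnj A = 1\<^sub>m 1 \<longleftrightarrow> A $$ (0, 0) \<in> gauss_unit_circle"
    if "A \<in> carrier_mat 1 1" for A :: "'a gauss mat"
    using that mult_gauss_cnj_eq_1_iff[of "A $$ (0, 0)"]
    by (auto simp: mat_eq_iff scalar_prod_def)
  have "bij_betw ?f gauss_unit_circle (coninvolutions 1)"
  proof (rule bij_betw_byWitness[where f' = "\<lambda>A. A $$ (0, 0)"])
    show "\<forall>A\<in>coninvolutions 1. ?f (A $$ (0, 0)) = A"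
      by (auto intro!: eq_matI simp: coninvolutions_def)
    show "?f ` gauss_unit_circle \<subseteq> coninvolutions 1"
      using iff by (auto simp: coninvolutions_def)
    show "(\<lambda>A. A $$ (0, 0)) ` coninvolutions 1 \<subseteq> (gauss_unit_circle :: 'a gauss set)"
      using iff by (auto simp: coninvolutions_def)
  qed auto
  then show ?thesis by (simp add: bij_betw_same_card)
qed

text \<open>Splitting off the last row and column contributes a choice on the unit circle and a
  corner of \<open>n\<close> entries, that is, a factor \<open>CARD('a) ^ n\<close>.\<close>

lemma card_coninvolutions:
  assumes half: "2 * h = (1 :: 'a :: {comm_ring_1, finite})"
  shows "card (coninvolutions n :: 'a gauss mat set) =
    card (gauss_unit_circle :: 'a gauss set) ^ n * CARD('a) ^ ((n - 1) * n div 2)"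
proof (induction n)
  case 0
  \<comment> \<open>The empty matrix is the only one, and the exponent is 0 because it has the
    factor \<open>n\<close>.\<close>
  have "coninvolutions 0 = {1\<^sub>m 0 :: 'a gauss mat}"
    by (auto simp: coninvolutions_def mat_eq_iff)
  then show ?case by simp
next
  case (Suc n)
  have "(Suc n - 1) * Suc n div 2 = (n - 1) * n div 2 + n"
    by (cases n) (simp_all add: algebra_simps)
  then show ?case
    using card_coninvolutions_add[OF half, of n 1] Suc card_coninvolutions_1[where 'a = 'a]
    by (simp add: power_add mult_ac)
qed

theorem theorem1p1:
  fixes p n :: nat
  assumes "p = CARD('p :: prime_card)" and "prime p" and "odd p" and "n \<ge> 1"
  shows "card {A \<in> upper_triangular_group n :: 'p mod_ring gauss mat set. coninvolution A}
       = card (gauss_unit_circle :: 'p mod_ring gauss set) ^ n * p ^ ((n - 1) * n div 2)"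
proof -
  obtain k where k: "p = 2 * k + 1" using \<open>odd p\<close> by (rule oddE)
  have "(of_nat p :: 'p mod_ring) = 0" using assms(1) by simp
  \<comment> \<open>As 2k + 1 = p vanishes modulo p, one half is -k.\<close>
  then have "2 * (- of_nat k) = (1 :: 'p mod_ring)"
    by (simp add: k) (metis add.commute minus_unique)
  from card_coninvolutions[OF this, of n] show ?thesis
    by (simp add: coninvolutions_eq assms(1))
qed

end
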